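(* Let $X$ be a Hilbert space, let $M\geq 1$, let $t_1,\dots,t_M$ be distinct points of $T$ and let $\omega_i:T\to T$ be the constant function $\omega_i(t)=t_i$ for all $t\in T$, $i=1,\dots,M$. Let $R_1,\dots,R_M\in\mathcal{L}(X)$, let $\mu^0\in cabv(X)$, and assume $$e=\sum_{i=1}^{M}\|R_i\|_o<1.$$ Define $H_2:cabv(X)\to cabv(X)$ via $$H_2(\mu)=H(\mu)+\mu^0=\sum_{i=1}^{M}\delta_{t_i}R_i(\mu(T))+\mu^0,$$ where $H(\mu)=\sum_{i=1}^{M}R_i\circ\omega_i(\mu)$. Then $H_2$ is a contraction with contraction factor $\leq e$ and possesses a unique $\mu^{\ast}\in cabv(X)$ with $H_2(\mu^{\ast})=\mu^{\ast}$. Moreover, writing $R=\sum_{i=1}^{M}R_i\in\mathcal{L}(X)$, it follows that $Id_X-R$ is invertible in $\mathcal{L}(X)$ and $$\mu^{\ast}=\sum_{i=1}^{M}\delta_{t_i}\,(R_i\circ(Id_X-R)^{-1})(\mu^0(T))+\mu^0.$$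
   Context: All vector spaces are non-null and over $K=\mathbb{R}$ or $\mathbb{C}$. $(T,d)$ is a compact metric space with at least two elements, $\mathcal{B}$ its Borel $\sigma$-algebra. A contraction is a Lipschitz self-map of a metric space with Lipschitz constant $<1$; this constant is its contraction factor. $\mathcal{L}(X)$ is the Banach algebra of continuous linear operators on $X$, with operator norm $\|\cdot\|_o$ and product given by composition. $cabv(X)$ is the Banach space of $\sigma$-additive $\mu:\mathcal{B}\to X$ with finite total variation, with the variational norm $\|\mu\|=|\mu|(T)=\sup\sum_i\|\mu(A_i)\|$ (supremum over finite Borel partitions $(A_i)$ of $T$); it is the norm used for the contraction statement. For continuous $h:T\to T$, $h(\mu)(B)=\mu(h^{-1}(B))$ for $B\in\mathcal{B}$; for $R\in\mathcal{L}(X)$, $(R\circ h(\mu))(B)=R(\mu(h^{-1}(B)))$. $\delta_t$ is the Dirac measure concentrated at $t$, and for $x\in X$, $\delta_t x$ is the measure $B\mapsto\delta_t(B)x$. *)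

theory Defs
  imports "HOL-Analysis.Analysis" "HOL-Probability.Giry_Monad"
begin

text \<open>
  The scalar field \<open>K\<close> is \<open>\<real>\<close> or \<open>\<complex>\<close>, both viewed as sets of complex numbers.
  The norm, its topology, completeness and the multiplication by real scalars come from the class
  \<^class>\<open>banach\<close>. The functions \<open>scaleK\<close> and \<open>ip\<close> are the multiplication by scalars from \<open>K\<close>
  and the inner product, which is linear in the first argument and induces the norm.
  For \<open>K = \<real>\<close> the values of \<open>scaleK\<close> at non-real numbers are irrelevant.
\<close>

locale hilbert_space =
  fixes K :: "complex set"
    and scaleK :: "complex \<Rightarrow> 'a::banach \<Rightarrow> 'a"
    and ip :: "'a \<Rightarrow> 'a \<Rightarrow> complex"
  assumes field: "K = \<real> \<or> K = UNIV"
    and non_null: "\<exists>x::'a. x \<noteq> 0"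
    and scale_add_right: "a \<in> K \<Longrightarrow> scaleK a (x + y) = scaleK a x + scaleK a y"
    and scale_add_left: "a \<in> K \<Longrightarrow> b \<in> K \<Longrightarrow> scaleK (a + b) x = scaleK a x + scaleK b x"
    and scale_scale: "a \<in> K \<Longrightarrow> b \<in> K \<Longrightarrow> scaleK a (scaleK b x) = scaleK (a * b) x"
    and scale_of_real: "scaleK (of_real r) x = r *\<^sub>R x"
    and ip_in_field: "ip x y \<in> K"
    and ip_add_left: "ip (x + y) z = ip x z + ip y z"
    and ip_scale_left: "a \<in> K \<Longrightarrow> ip (scaleK a x) y = a * ip x y"
    and ip_commute: "ip y x = cnj (ip x y)"
    and ip_self: "ip x x = of_real ((norm x)\<^sup>2)"

text \<open>
  The space of continuous \<open>K\<close>-linear operators, as a subset of the bounded real-linear ones.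
  The norm of \<^typ>\<open>'a \<Rightarrow>\<^sub>L 'a\<close> is the operator norm.
\<close>

definition operators :: "complex set \<Rightarrow> (complex \<Rightarrow> 'a \<Rightarrow> 'a) \<Rightarrow> ('a::real_normed_vector \<Rightarrow>\<^sub>L 'a) set"
  where "operators K scaleK = {R. \<forall>a\<in>K. \<forall>x. blinfun_apply R (scaleK a x) = scaleK a (blinfun_apply R x)}"

definition is_inverse_operator ::
  "complex set \<Rightarrow> (complex \<Rightarrow> 'a \<Rightarrow> 'a) \<Rightarrow> ('a::real_normed_vector \<Rightarrow>\<^sub>L 'a) \<Rightarrow> ('a \<Rightarrow>\<^sub>L 'a) \<Rightarrow> bool"
  where "is_inverse_operator K scaleK A S \<longleftrightarrow>
    S \<in> operators K scaleK \<and> A o\<^sub>L S = id_blinfun \<and> S o\<^sub>L A = id_blinfun"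

definition invertible_operator ::
  "complex set \<Rightarrow> (complex \<Rightarrow> 'a \<Rightarrow> 'a) \<Rightarrow> ('a::real_normed_vector \<Rightarrow>\<^sub>L 'a) \<Rightarrow> bool"
  where "invertible_operator K scaleK A \<longleftrightarrow>
    A \<in> operators K scaleK \<and> (\<exists>S. is_inverse_operator K scaleK A S)"

definition inverse_operator ::
  "complex set \<Rightarrow> (complex \<Rightarrow> 'a \<Rightarrow> 'a) \<Rightarrow> ('a::real_normed_vector \<Rightarrow>\<^sub>L 'a) \<Rightarrow> ('a \<Rightarrow>\<^sub>L 'a)"
  where "inverse_operator K scaleK A = (THE S. is_inverse_operator K scaleK A S)"

definition borel_partitions :: "'t::topological_space set set set"
  where "borel_partitions = {P. finite P \<and> P \<subseteq> sets borel \<and> partition_on UNIV P}"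

definition total_variation :: "('t::topological_space set \<Rightarrow> 'a::real_normed_vector) \<Rightarrow> ennreal"
  where "total_variation \<mu> = (SUP P\<in>borel_partitions. \<Sum>A\<in>P. ennreal (norm (\<mu> A)))"

definition vector_measure :: "('t::topological_space set \<Rightarrow> 'a::real_normed_vector) \<Rightarrow> bool"
  where "vector_measure \<mu> \<longleftrightarrow>
    (\<forall>A::nat \<Rightarrow> 't set. range A \<subseteq> sets borel \<longrightarrow> disjoint_family A \<longrightarrow>
       (\<lambda>n. \<mu> (A n)) sums \<mu> (\<Union>n. A n))"

text \<open>
  A measure is represented by a total function on sets that vanishes outside the Borel sets, so
  that equality of functions is equality of measures.
\<close>

definition cabv :: "('t::topological_space set \<Rightarrow> 'a::real_normed_vector) set"
  where "cabv = {\<mu>. vector_measure \<mu> \<and> total_variation \<mu> < \<infinity> \<and> (\<forall>B. B \<notin> sets borel \<longrightarrow> \<mu> B = 0)}"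

definition variation_norm :: "('t::topological_space set \<Rightarrow> 'a::real_normed_vector) \<Rightarrow> real"
  where "variation_norm \<mu> = enn2real (total_variation \<mu>)"

definition variation_dist ::
  "('t::topological_space set \<Rightarrow> 'a::real_normed_vector) \<Rightarrow> ('t set \<Rightarrow> 'a) \<Rightarrow> real"
  where "variation_dist \<mu> \<nu> = variation_norm (\<lambda>B. \<mu> B - \<nu> B)"

definition cabv_metric :: "('t::topological_space set \<Rightarrow> 'a::real_normed_vector) metric"
  where "cabv_metric = metric (cabv, variation_dist)"

definition image_measure ::
  "('t::topological_space \<Rightarrow> 't) \<Rightarrow> ('t set \<Rightarrow> 'a::real_normed_vector) \<Rightarrow> 't set \<Rightarrow> 'a"
  where "image_measure h \<mu> = (\<lambda>B. if B \<in> sets borel then \<mu> (h -` B) else 0)"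

text \<open>The measure \<open>\<delta>\<^sub>t x\<close>; \<^const>\<open>measure\<close> is zero on sets that are not measurable.\<close>

definition dirac :: "'t::topological_space \<Rightarrow> 'a::real_normed_vector \<Rightarrow> 't set \<Rightarrow> 'a"
  where "dirac t x = (\<lambda>B. measure (return borel t) B *\<^sub>R x)"

definition ifs_operator ::
  "nat \<Rightarrow> (nat \<Rightarrow> 't \<Rightarrow> 't) \<Rightarrow> (nat \<Rightarrow> 'a \<Rightarrow>\<^sub>L 'a) \<Rightarrow>
    ('t::topological_space set \<Rightarrow> 'a::real_normed_vector) \<Rightarrow> 't set \<Rightarrow> 'a"
  where "ifs_operator M \<omega> R \<mu> =
    (\<lambda>B. \<Sum>i=1..M. (blinfun_apply (R i) \<circ> image_measure (\<omega> i) \<mu>) B)"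

definition lipschitz_constant :: "'m metric \<Rightarrow> ('m \<Rightarrow> 'm) \<Rightarrow> real"
  where "lipschitz_constant m f =
    Inf {L. 0 \<le> L \<and> (\<forall>x\<in>mspace m. \<forall>y\<in>mspace m. mdist m (f x) (f y) \<le> L * mdist m x y)}"

definition contraction :: "'m metric \<Rightarrow> ('m \<Rightarrow> 'm) \<Rightarrow> bool"
  where "contraction m f \<longleftrightarrow> Lipschitz_continuous_map m m f \<and> lipschitz_constant m f < 1"

lemma total_variation_ge:
  assumes "P \<in> borel_partitions"
  shows "(\<Sum>A\<in>P. ennreal (norm (\<mu> A))) \<le> total_variation \<mu>"
  unfolding total_variation_def by (rule SUP_upper[OF assms])

lemma norm_le_total_variation:
  fixes \<mu> :: "'t::topological_space set \<Rightarrow> 'a::real_normed_vector"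
  assumes B: "B \<in> sets borel" and "B \<noteq> {}"
  shows "ennreal (norm (\<mu> B)) \<le> total_variation \<mu>"
proof -
  define P where "P = {B, - B} - {{}}"
  have "P \<in> borel_partitions"
    using B unfolding borel_partitions_def P_def partition_on_def disjoint_def
    by (auto simp: borel_comp)
  moreover have "ennreal (norm (\<mu> B)) \<le> (\<Sum>A\<in>P. ennreal (norm (\<mu> A)))"
    using assms(2) by (intro member_le_sum) (auto simp: P_def)
  ultimately show ?thesis
    using total_variation_ge order_trans by blast
qed

lemma total_variation_diff_le:
  "total_variation (\<lambda>B. \<mu> B - \<nu> B) \<le> total_variation \<mu> + total_variation \<nu>"
  unfolding total_variation_def[of "\<lambda>B. \<mu> B - \<nu> B"]
proof (rule SUP_least)
  fix P :: "'a set set" assume P: "P \<in> borel_partitions"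
  have "(\<Sum>A\<in>P. ennreal (norm (\<mu> A - \<nu> A)))
      \<le> (\<Sum>A\<in>P. ennreal (norm (\<mu> A)) + ennreal (norm (\<nu> A)))"
    by (intro sum_mono) (simp flip: ennreal_plus add: norm_triangle_ineq4 ennreal_leI)
  also have "\<dots> \<le> total_variation \<mu> + total_variation \<nu>"
    unfolding sum.distrib by (intro add_mono total_variation_ge[OF P])
  finally show "(\<Sum>A\<in>P. ennreal (norm (\<mu> A - \<nu> A))) \<le> total_variation \<mu> + total_variation \<nu>" .
qed

lemma vector_measure_empty:
  assumes "vector_measure \<mu>"
  shows "\<mu> {} = 0"
proof -
  have "(\<lambda>n::nat. \<mu> {}) sums \<mu> (\<Union>n::nat. {})"
    using assms unfolding vector_measure_def by (auto simp: disjoint_family_on_def)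
  then show ?thesis
    by (auto dest: sums_summable simp: summable_const_iff)
qed

lemma cabv_diff:
  assumes "\<mu> \<in> cabv" "\<nu> \<in> cabv"
  shows "(\<lambda>B. \<mu> B - \<nu> B) \<in> cabv"
proof -
  have "total_variation (\<lambda>B. \<mu> B - \<nu> B) < \<infinity>"
    using total_variation_diff_le[of \<mu> \<nu>] assms unfolding cabv_def
    by (auto simp: less_top intro: le_less_trans)
  then show ?thesis
    using assms unfolding cabv_def vector_measure_def by (auto intro: sums_diff)
qed

lemma Metric_space_cabv:
  "Metric_space (cabv :: ('t::topological_space set \<Rightarrow> 'a::real_normed_vector) set) variation_dist"
proof
  fix \<mu> \<nu> \<rho> :: "'t set \<Rightarrow> 'a"
  show "0 \<le> variation_dist \<mu> \<nu>"
    by (simp add: variation_dist_def variation_norm_def)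
  show "variation_dist \<mu> \<nu> = variation_dist \<nu> \<mu>"
    by (simp add: variation_dist_def variation_norm_def total_variation_def norm_minus_commute)
  assume \<mu>: "\<mu> \<in> cabv" and \<nu>: "\<nu> \<in> cabv"
  show "variation_dist \<mu> \<nu> = 0 \<longleftrightarrow> \<mu> = \<nu>"
  proof
    assume "variation_dist \<mu> \<nu> = 0"
    moreover have "total_variation (\<lambda>B. \<mu> B - \<nu> B) < \<infinity>"
      using cabv_diff[OF \<mu> \<nu>] by (simp add: cabv_def)
    ultimately have tv: "total_variation (\<lambda>B. \<mu> B - \<nu> B) = 0"
      by (auto simp: variation_dist_def variation_norm_def enn2real_eq_0_iff)
    show "\<mu> = \<nu>"
    proof
      fix B :: "'t set"
      consider "B \<notin> sets borel" | "B = {}" | "B \<in> sets borel" "B \<noteq> {}" by blast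
      then show "\<mu> B = \<nu> B"
      proof cases
        case 1
        then show ?thesis using \<mu> \<nu> by (simp add: cabv_def)
      next
        case 2
        then show ?thesis using \<mu> \<nu> by (simp add: cabv_def vector_measure_empty)
      next
        case 3
        then show ?thesis
          using norm_le_total_variation[of B "\<lambda>B. \<mu> B - \<nu> B"] tv by simp
      qed
    qed
  next
    assume "\<mu> = \<nu>"
    moreover have "total_variation (\<lambda>B::'t set. 0::'a) = 0"
      using le_zero_eq by (fastforce simp: total_variation_def intro: SUP_least)
    ultimately show "variation_dist \<mu> \<nu> = 0"
      by (simp add: variation_dist_def variation_norm_def)
  qed
  assume \<rho>: "\<rho> \<in> cabv"
  have "total_variation (\<lambda>B. \<mu> B - \<rho> B)
      = total_variation (\<lambda>B. (\<mu> B - \<nu> B) - (\<rho> B - \<nu> B))" by simp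
  also have "\<dots> \<le> total_variation (\<lambda>B. \<mu> B - \<nu> B) + total_variation (\<lambda>B. \<rho> B - \<nu> B)"
    by (rule total_variation_diff_le)
  also have "total_variation (\<lambda>B. \<rho> B - \<nu> B) = total_variation (\<lambda>B. \<nu> B - \<rho> B)"
    by (simp add: total_variation_def norm_minus_commute)
  finally have le: "total_variation (\<lambda>B. \<mu> B - \<rho> B)
      \<le> total_variation (\<lambda>B. \<mu> B - \<nu> B) + total_variation (\<lambda>B. \<nu> B - \<rho> B)" .
  have fin: "total_variation (\<lambda>B. \<mu> B - \<nu> B) < top" "total_variation (\<lambda>B. \<nu> B - \<rho> B) < top"
    using cabv_diff[OF \<mu> \<nu>] cabv_diff[OF \<nu> \<rho>] by (simp_all add: cabv_def)
  then show "variation_dist \<mu> \<rho> \<le> variation_dist \<mu> \<nu> + variation_dist \<nu> \<rho>"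
    using enn2real_mono[OF le] by (simp add: variation_dist_def variation_norm_def enn2real_plus)
qed

lemma mspace_cabv_metric [simp]: "mspace cabv_metric = cabv"
  and mdist_cabv_metric [simp]: "mdist cabv_metric = variation_dist"
  by (simp_all add: cabv_metric_def Metric_space.mspace_metric Metric_space.mdist_metric
      Metric_space_cabv)

end

theory Submission
  imports Defs
begin

text \<open>
  Since every \<open>\<omega>\<^sub>i\<close> is constant, \<open>H\<^sub>2(\<mu>)\<close> depends on \<open>\<mu>\<close> only through the single vector
  \<open>\<mu>(T)\<close>: it is \<open>\<Sum>\<^sub>i \<delta>\<^bsub>t\<^sub>i\<^esub> R\<^sub>i(\<mu>(T)) + \<mu>\<^sup>0\<close> (lemma \<open>ifs_operator_constant\<close>).
  A Dirac measure \<open>\<delta>\<^sub>t x\<close> has variation at most \<open>\<parallel>x\<parallel>\<close>, and \<open>\<parallel>\<mu>(T)\<parallel> \<le> \<parallel>\<mu>\<parallel>\<close>, so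
  differences of images are bounded by \<open>\<Sum>\<^sub>i \<parallel>R\<^sub>i\<parallel> \<parallel>(\<mu> - \<nu>)(T)\<parallel> \<le> e \<parallel>\<mu> - \<nu>\<parallel>\<close>
  (lemma \<open>variation_norm_dirac_sum_le\<close>).

  The same observation reduces the fixed point equation to a linear equation in \<open>X\<close>.
  Evaluating \<open>\<mu> = H\<^sub>2(\<mu>)\<close> on \<open>T\<close> gives
  \<open>(Id - R)(\<mu>(T)) = \<mu>\<^sup>0(T)\<close>. As \<open>\<parallel>R\<parallel> \<le> e < 1\<close>, the operator \<open>Id - R\<close> is invertible
  (lemma \<open>inverse_id_minus_exists\<close>), so \<open>\<mu>(T)\<close>, and with it \<open>\<mu> = H\<^sub>2(\<mu>)\<close>, is determined and
  has the asserted form. Conversely, the measure given by that form has total mass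
  \<open>R (Id - R)\<^sup>-\<^sup>1 \<mu>\<^sup>0(T) + \<mu>\<^sup>0(T) = (Id - R)\<^sup>-\<^sup>1 \<mu>\<^sup>0(T)\<close>, hence is a fixed point.
\<close>

section \<open>Inverting a perturbation of the identity\<close>

text \<open>
  Solving \<open>x - R x = y\<close> amounts to finding the fixed point of the contraction \<open>x \<mapsto> R x + y\<close>.
  The inverse is bounded because \<open>\<parallel>x\<parallel> \<le> \<parallel>R\<parallel> \<parallel>x\<parallel> + \<parallel>x - R x\<parallel>\<close>.
\<close>

lemma inverse_id_minus_exists:
  fixes R :: "'a::banach \<Rightarrow>\<^sub>L 'a"
  assumes "norm R < 1"
  shows "\<exists>S. (id_blinfun - R) o\<^sub>L S = id_blinfun \<and> S o\<^sub>L (id_blinfun - R) = id_blinfun"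
proof -
  have ex1: "\<exists>!x. R x + y = x" for y
  proof (rule banach_fix_type[OF norm_ge_zero assms], intro allI)
    show "dist (R x + y) (R z + y) \<le> norm R * dist x z" for x z
      using norm_blinfun[of R "x - z"] by (simp add: dist_norm blinfun.diff_right)
  qed
  define s where "s y = (THE x. R x + y = x)" for y
  have s: "R (s y) + y = s y" for y
    unfolding s_def by (rule theI'[OF ex1])
  have s_unique: "s y = x" if "R x + y = x" for x y
    using ex1[of y] s[of y] that by blast
  have "bounded_linear s"
  proof (rule bounded_linear_intro[where K = "1 / (1 - norm R)"])
    fix x y and r :: real
    have "R (s x + s y) + (x + y) = (R (s x) + x) + (R (s y) + y)"
      by (simp add: blinfun.add_right)
    also have "\<dots> = s x + s y" by (simp only: s)
    finally show "s (x + y) = s x + s y" by (rule s_unique)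
    have "R (r *\<^sub>R s x) + r *\<^sub>R x = r *\<^sub>R (R (s x) + x)"
      by (simp add: blinfun.scaleR_right scaleR_right_distrib)
    also have "\<dots> = r *\<^sub>R s x" by (simp only: s)
    finally show "s (r *\<^sub>R x) = r *\<^sub>R s x" by (rule s_unique)
    have "norm (s x) \<le> norm R * norm (s x) + norm x"
      using norm_triangle_ineq[of "R (s x)" x] norm_blinfun[of R "s x"] by (simp add: s)
    then show "norm (s x) \<le> norm x * (1 / (1 - norm R))"
      using assms by (simp add: field_simps)
  qed
  then have ap: "blinfun_apply (Blinfun s) = s"
    by (rule bounded_linear_Blinfun_apply)
  have "s y - R (s y) = y" for y
    using s[of y] by (simp add: algebra_simps)
  moreover have "s (x - R x) = x" for x
    by (rule s_unique) simp
  ultimately have "(id_blinfun - R) o\<^sub>L Blinfun s = id_blinfun"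
    and "Blinfun s o\<^sub>L (id_blinfun - R) = id_blinfun"
    by (auto intro!: blinfun_eqI simp: ap blinfun.diff_left)
  then show ?thesis by blast
qed

lemma inverse_in_operators:
  assumes A: "A \<in> operators K scaleK"
    and AS: "A o\<^sub>L S = id_blinfun" and SA: "S o\<^sub>L A = id_blinfun"
  shows "S \<in> operators K scaleK"
  unfolding operators_def
proof (intro CollectI ballI allI)
  fix a x assume a: "a \<in> K"
  have AS': "A (S y) = y" and SA': "S (A y) = y" for y
    using arg_cong[OF AS, of "\<lambda>f. blinfun_apply f y"] arg_cong[OF SA, of "\<lambda>f. blinfun_apply f y"]
    by simp_all
  have "A (scaleK a (S x)) = scaleK a (A (S x))"
    using A a unfolding operators_def by blast
  then have "A (scaleK a (S x)) = scaleK a x" by (simp only: AS')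
  then show "S (scaleK a x) = scaleK a (S x)" using SA'[of "scaleK a (S x)"] by simp
qed

lemma inverse_operator_eqI:
  assumes "is_inverse_operator K scaleK A S"
  shows "inverse_operator K scaleK A = S"
  unfolding inverse_operator_def
proof (rule the_equality)
  show "is_inverse_operator K scaleK A S" by fact
  fix S' assume S': "is_inverse_operator K scaleK A S'"
  show "S' = S"
  proof (rule blinfun_eqI)
    fix x
    have "S' (A (S x)) = S x"
      using S' unfolding is_inverse_operator_def
      by (metis blinfun_apply_blinfun_compose id_blinfun.rep_eq id_apply)
    moreover have "A (S x) = x"
      using assms unfolding is_inverse_operator_def
      by (metis blinfun_apply_blinfun_compose id_blinfun.rep_eq id_apply)
    ultimately show "S' x = S x" by simp
  qed
qed

context hilbert_space
begin

lemma scaleK_zero: "a \<in> K \<Longrightarrow> scaleK a 0 = 0"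
  using scale_add_right[of a 0 0] by simp

lemma scaleK_diff: "a \<in> K \<Longrightarrow> scaleK a (x - y) = scaleK a x - scaleK a y"
  using scale_add_right[of a "x - y" y] by simp

lemma id_in_operators: "id_blinfun \<in> operators K scaleK"
  by (simp add: operators_def)

lemma diff_in_operators:
  "A \<in> operators K scaleK \<Longrightarrow> B \<in> operators K scaleK \<Longrightarrow> A - B \<in> operators K scaleK"
  by (simp add: operators_def blinfun.diff_left scaleK_diff)

lemma sum_in_operators:
  "(\<And>i. i \<in> I \<Longrightarrow> R i \<in> operators K scaleK) \<Longrightarrow> sum R I \<in> operators K scaleK"
  by (induction I rule: infinite_finite_induct)
    (simp_all add: operators_def blinfun.add_left scale_add_right scaleK_zero)

end

section \<open>Measures of finite variation\<close>

lemma cabv_zero: "(\<lambda>B::'b::topological_space set. 0::'a::real_normed_vector) \<in> cabv"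
proof -
  have "total_variation (\<lambda>B::'b set. 0::'a) \<le> 0"
    unfolding total_variation_def by (rule SUP_least) simp
  then show ?thesis by (simp add: cabv_def vector_measure_def)
qed

lemma cabv_add:
  assumes "\<mu> \<in> cabv" "\<nu> \<in> cabv"
  shows "(\<lambda>B. \<mu> B + \<nu> B) \<in> cabv"
  using cabv_diff[OF assms(1) cabv_diff[OF cabv_zero assms(2)]] by simp

lemma cabv_sum:
  assumes "\<And>i. i \<in> I \<Longrightarrow> \<mu> i \<in> cabv"
  shows "(\<lambda>B. \<Sum>i\<in>I. \<mu> i B) \<in> cabv"
  using assms by (induction I rule: infinite_finite_induct) (simp_all add: cabv_zero cabv_add)

lemma total_variation_sum_le:
  "total_variation (\<lambda>B. \<Sum>i\<in>I. \<mu> i B) \<le> (\<Sum>i\<in>I. total_variation (\<mu> i))"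
  unfolding total_variation_def[of "\<lambda>B. \<Sum>i\<in>I. \<mu> i B"]
proof (rule SUP_least)
  fix P :: "'a set set" assume P: "P \<in> borel_partitions"
  have "(\<Sum>A\<in>P. ennreal (norm (\<Sum>i\<in>I. \<mu> i A))) \<le> (\<Sum>A\<in>P. \<Sum>i\<in>I. ennreal (norm (\<mu> i A)))"
    by (intro sum_mono) (simp add: sum_ennreal norm_sum ennreal_leI)
  also have "\<dots> = (\<Sum>i\<in>I. \<Sum>A\<in>P. ennreal (norm (\<mu> i A)))"
    by (rule sum.swap)
  also have "\<dots> \<le> (\<Sum>i\<in>I. total_variation (\<mu> i))"
    by (intro sum_mono total_variation_ge[OF P])
  finally show "(\<Sum>A\<in>P. ennreal (norm (\<Sum>i\<in>I. \<mu> i A))) \<le> (\<Sum>i\<in>I. total_variation (\<mu> i))" .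
qed

lemma norm_UNIV_le_variation_norm:
  assumes "\<mu> \<in> cabv"
  shows "norm (\<mu> UNIV) \<le> variation_norm \<mu>"
proof -
  have "ennreal (norm (\<mu> UNIV)) \<le> total_variation \<mu>"
    by (rule norm_le_total_variation) auto
  then have "enn2real (ennreal (norm (\<mu> UNIV))) \<le> enn2real (total_variation \<mu>)"
    using assms by (intro enn2real_mono) (auto simp: cabv_def)
  then show ?thesis by (simp add: variation_norm_def)
qed

section \<open>Dirac measures\<close>

lemma dirac_borel: "B \<in> sets borel \<Longrightarrow> dirac t x B = indicator B t *\<^sub>R x"
  by (simp add: dirac_def measure_return)

lemma dirac_non_borel: "B \<notin> sets borel \<Longrightarrow> dirac t x B = 0"
  by (simp add: dirac_def measure_notin_sets)

lemma dirac_diff: "dirac t x B - dirac t y B = dirac t (x - y) B"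
  by (simp add: dirac_def scaleR_right_diff_distrib)

text \<open>At most one cell of a partition contains \<open>t\<close>, and only that cell contributes.\<close>

lemma total_variation_dirac_le: "total_variation (dirac t x) \<le> ennreal (norm x)"
  unfolding total_variation_def
proof (rule SUP_least)
  fix P :: "'a set set" assume "P \<in> borel_partitions"
  then have fin: "finite P" and borel: "P \<subseteq> sets borel" and part: "partition_on UNIV P"
    by (auto simp: borel_partitions_def)
  have "t \<in> \<Union>P"
    using part by (simp add: partition_on_def)
  then obtain C where C: "C \<in> P" "t \<in> C"
    by blast
  have other: "t \<notin> A" if "A \<in> P" "A \<noteq> C" for A
    using part C that by (auto simp: partition_on_def disjoint_def)
  have "(\<Sum>A\<in>P. ennreal (norm (dirac t x A))) = (\<Sum>A\<in>P. if A = C then ennreal (norm x) else 0)"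
    using borel C other by (intro sum.cong) (auto simp: dirac_borel subset_iff)
  then show "(\<Sum>A\<in>P. ennreal (norm (dirac t x A))) \<le> ennreal (norm x)"
    using fin C by simp
qed

lemma dirac_cabv: "dirac t x \<in> cabv"
proof -
  interpret prob_space "return borel t" by (rule prob_space_return) simp
  have "vector_measure (dirac t x)"
    unfolding vector_measure_def dirac_def
    by (auto intro!: sums_scaleR_left finite_measure_UNION)
  moreover have "total_variation (dirac t x) < \<infinity>"
    using total_variation_dirac_le[of t x] by (rule le_less_trans) simp
  ultimately show ?thesis
    by (simp add: cabv_def dirac_non_borel)
qed

lemma dirac_sum_cabv: "(\<lambda>B. \<Sum>i\<in>I. dirac (t i) (x i) B) \<in> cabv"
  by (rule cabv_sum) (rule dirac_cabv)

lemma variation_norm_dirac_sum_le: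
  "variation_norm (\<lambda>B. \<Sum>i\<in>I. dirac (t i) (x i) B) \<le> (\<Sum>i\<in>I. norm (x i))"
proof -
  have "total_variation (\<lambda>B. \<Sum>i\<in>I. dirac (t i) (x i) B)
      \<le> (\<Sum>i\<in>I. total_variation (dirac (t i) (x i)))"
    by (rule total_variation_sum_le)
  also have "\<dots> \<le> (\<Sum>i\<in>I. ennreal (norm (x i)))"
    by (intro sum_mono total_variation_dirac_le)
  also have "\<dots> = ennreal (\<Sum>i\<in>I. norm (x i))"
    by (simp add: sum_ennreal)
  finally have le: "total_variation (\<lambda>B. \<Sum>i\<in>I. dirac (t i) (x i) B)
      \<le> ennreal (\<Sum>i\<in>I. norm (x i))" .
  show ?thesis
    using enn2real_mono[OF le] by (simp add: variation_norm_def sum_nonneg)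
qed

section \<open>The operator of a constant function system\<close>

text \<open>
  The preimage of \<open>B\<close> under a constant function with value \<open>t\<close> is the whole space or empty
  according to whether \<open>t\<close> lies in \<open>B\<close>.
\<close>

lemma ifs_operator_constant:
  assumes \<mu>: "vector_measure \<mu>" and \<omega>: "\<And>i x. i \<in> {1..M} \<Longrightarrow> \<omega> i x = t i"
  shows "ifs_operator M \<omega> R \<mu> B = (\<Sum>i=1..M. dirac (t i) (R i (\<mu> UNIV)) B)"
  unfolding ifs_operator_def
proof (rule sum.cong[OF refl])
  fix i assume i: "i \<in> {1..M}"
  have "\<omega> i -` B = (if t i \<in> B then UNIV else {})"
    using \<omega>[OF i] by auto
  then show "(blinfun_apply (R i) \<circ> image_measure (\<omega> i) \<mu>) B = dirac (t i) (R i (\<mu> UNIV)) B"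
    by (cases "B \<in> sets borel")
      (simp_all add: image_measure_def dirac_borel dirac_non_borel vector_measure_empty[OF \<mu>])
qed

lemma lipschitz_constant_le:
  assumes "0 \<le> L"
    and "\<And>x y. x \<in> mspace m \<Longrightarrow> y \<in> mspace m \<Longrightarrow> mdist m (f x) (f y) \<le> L * mdist m x y"
  shows "lipschitz_constant m f \<le> L"
  unfolding lipschitz_constant_def using assms by (intro cInf_lower bdd_belowI[of _ 0]) auto

theorem theorem2p3p1:
  fixes K :: "complex set"
    and scaleK :: "complex \<Rightarrow> 'a::banach \<Rightarrow> 'a"
    and ip :: "'a \<Rightarrow> 'a \<Rightarrow> complex"
    and M :: nat
    and t :: "nat \<Rightarrow> 't::metric_space"
    and \<omega> :: "nat \<Rightarrow> 't \<Rightarrow> 't"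
    and R :: "nat \<Rightarrow> 'a \<Rightarrow>\<^sub>L 'a"
    and R_sum :: "'a \<Rightarrow>\<^sub>L 'a"
    and \<mu>0 :: "'t set \<Rightarrow> 'a"
    and e :: real
    and H2 :: "('t set \<Rightarrow> 'a) \<Rightarrow> ('t set \<Rightarrow> 'a)"
  assumes "hilbert_space K scaleK ip"
    and "compact (UNIV :: 't set)"
    and "\<exists>a b :: 't. a \<noteq> b"
    and "M \<ge> 1"
    and "inj_on t {1..M}"
    and "\<And>i x. i \<in> {1..M} \<Longrightarrow> \<omega> i x = t i"
    and "\<And>i. i \<in> {1..M} \<Longrightarrow> R i \<in> operators K scaleK"
    and "\<mu>0 \<in> cabv"
    and "e = (\<Sum>i=1..M. norm (R i))"
    and "e < 1"
    and "\<And>\<mu>. \<mu> \<in> cabv \<Longrightarrow> H2 \<mu> = (\<lambda>B. ifs_operator M \<omega> R \<mu> B + \<mu>0 B)"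
    and "R_sum = (\<Sum>i=1..M. R i)"
  shows "H2 \<in> cabv \<rightarrow> cabv
    \<and> (\<forall>\<mu>\<in>cabv. H2 \<mu> = (\<lambda>B. (\<Sum>i=1..M. dirac (t i) (blinfun_apply (R i) (\<mu> UNIV)) B) + \<mu>0 B))
    \<and> contraction cabv_metric H2
    \<and> lipschitz_constant cabv_metric H2 \<le> e
    \<and> (\<exists>!\<mu>. \<mu> \<in> cabv \<and> H2 \<mu> = \<mu>)
    \<and> R_sum \<in> operators K scaleK
    \<and> invertible_operator K scaleK (id_blinfun - R_sum)
    \<and> (\<forall>\<mu>s\<in>cabv. H2 \<mu>s = \<mu>s \<longrightarrow>
         \<mu>s = (\<lambda>B. (\<Sum>i=1..M. dirac (t i)
           (blinfun_apply (R i o\<^sub>L inverse_operator K scaleK (id_blinfun - R_sum)) (\<mu>0 UNIV)) B) + \<mu>0 B))"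
proof -
  interpret hilbert_space K scaleK ip by fact
  note \<omega> = assms(6) and R = assms(7) and \<mu>0 = assms(8) and e = assms(9) and e_less = assms(10)
    and H2 = assms(11) and R_sum = assms(12)
  \<comment> \<open>The only possible values of \<open>H\<^sub>2\<close> on \<open>cabv\<close>, parametrised by the total mass \<open>x\<close> of the argument.\<close>
  define D where "D x = (\<lambda>B. (\<Sum>i=1..M. dirac (t i) (R i x) B) + \<mu>0 B)" for x
  have H2_D: "H2 \<mu> = D (\<mu> UNIV)" if "\<mu> \<in> cabv" for \<mu>
  proof -
    have "vector_measure \<mu>" using that by (simp add: cabv_def)
    from ifs_operator_constant[OF this \<omega>] show ?thesis
      by (simp add: H2[OF that] D_def)
  qed
  have D_cabv: "D x \<in> cabv" for x
    unfolding D_def by (intro cabv_add dirac_sum_cabv \<mu>0)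
  have D_UNIV: "D x UNIV = R_sum x + \<mu>0 UNIV" for x
    by (simp add: D_def dirac_borel R_sum blinfun.sum_left)
  have maps: "H2 \<in> cabv \<rightarrow> cabv"
    by (simp add: H2_D D_cabv)

  have e_nonneg: "0 \<le> e" by (simp add: e sum_nonneg)
  have lip: "variation_dist (H2 \<mu>) (H2 \<nu>) \<le> e * variation_dist \<mu> \<nu>"
    if \<mu>: "\<mu> \<in> cabv" and \<nu>: "\<nu> \<in> cabv" for \<mu> \<nu>
  proof -
    let ?x = "\<mu> UNIV - \<nu> UNIV"
    have "variation_dist (H2 \<mu>) (H2 \<nu>)
        = variation_norm (\<lambda>B. \<Sum>i=1..M. dirac (t i) (R i ?x) B)"
      by (simp add: variation_dist_def H2_D \<mu> \<nu> D_def dirac_diff blinfun.diff_right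
          flip: sum_subtractf)
    also have "\<dots> \<le> (\<Sum>i=1..M. norm (R i ?x))"
      by (rule variation_norm_dirac_sum_le)
    also have "\<dots> \<le> e * norm ?x"
      unfolding e sum_distrib_right by (intro sum_mono norm_blinfun)
    also have "\<dots> \<le> e * variation_dist \<mu> \<nu>"
      unfolding variation_dist_def
      using norm_UNIV_le_variation_norm[OF cabv_diff[OF \<mu> \<nu>]] e_nonneg
      by (rule mult_left_mono)
    finally show ?thesis .
  qed
  have const: "lipschitz_constant cabv_metric H2 \<le> e"
    using e_nonneg lip by (intro lipschitz_constant_le) simp_all
  have contr: "contraction cabv_metric H2"
    using maps lip const e_less unfolding contraction_def Lipschitz_continuous_map_def
    by auto

  have R_sum_op: "R_sum \<in> operators K scaleK"
    unfolding R_sum using R by (rule sum_in_operators)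
  then have diff_op: "id_blinfun - R_sum \<in> operators K scaleK"
    by (intro diff_in_operators id_in_operators)
  have "norm R_sum < 1"
    using norm_sum[of R "{1..M}"] e e_less R_sum by simp
  then obtain S where AS: "(id_blinfun - R_sum) o\<^sub>L S = id_blinfun"
    and SA: "S o\<^sub>L (id_blinfun - R_sum) = id_blinfun"
    using inverse_id_minus_exists by blast
  have inv: "is_inverse_operator K scaleK (id_blinfun - R_sum) S"
    using inverse_in_operators[OF diff_op AS SA] AS SA by (simp add: is_inverse_operator_def)
  then have invertible: "invertible_operator K scaleK (id_blinfun - R_sum)"
    using diff_op by (auto simp: invertible_operator_def)
  have S_eq: "inverse_operator K scaleK (id_blinfun - R_sum) = S"
    using inv by (rule inverse_operator_eqI)
  have right: "S y - R_sum (S y) = y" for y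
    using arg_cong[OF AS, of "\<lambda>f. blinfun_apply f y"] by (simp add: blinfun.diff_left)
  have left: "S (y - R_sum y) = y" for y
    using arg_cong[OF SA, of "\<lambda>f. blinfun_apply f y"] by (simp add: blinfun.diff_left)

  have fixed_eq: "\<mu> = D (S (\<mu>0 UNIV))" if \<mu>: "\<mu> \<in> cabv" and fixed: "H2 \<mu> = \<mu>" for \<mu>
  proof -
    have \<mu>_D: "\<mu> = D (\<mu> UNIV)"
      using H2_D[OF \<mu>] fixed by simp
    have "\<mu> UNIV = R_sum (\<mu> UNIV) + \<mu>0 UNIV"
      using fun_cong[OF \<mu>_D, of UNIV] unfolding D_UNIV .
    then have "\<mu>0 UNIV = \<mu> UNIV - R_sum (\<mu> UNIV)"
      by (simp add: algebra_simps)
    then have "\<mu> UNIV = S (\<mu>0 UNIV)"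
      by (simp only: left)
    then show ?thesis using \<mu>_D by simp
  qed
  have "D (S (\<mu>0 UNIV)) UNIV = S (\<mu>0 UNIV)"
    using right[of "\<mu>0 UNIV"] by (simp add: D_UNIV algebra_simps)
  then have "H2 (D (S (\<mu>0 UNIV))) = D (S (\<mu>0 UNIV))"
    by (simp add: H2_D D_cabv)
  then have unique: "\<exists>!\<mu>. \<mu> \<in> cabv \<and> H2 \<mu> = \<mu>"
    using D_cabv fixed_eq by blast

  show ?thesis
    using maps contr const unique R_sum_op invertible fixed_eq H2_D
    by (simp add: S_eq D_def)
qed

end
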